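(* Let $p\in\mathbb{C}[z]$ be a polynomial of degree $d\ge 1$, let $\Delta=D(c,r)$ be a complex disc with $c\in\mathbb{C}$, $r>0$, and suppose that $\Delta$ has isolation ratio $\rho>1$ for $p$. Let $\theta=1/\rho$ and let $s_0$ be the $0$-th power sum of the roots of $p$ in $\Delta$, i.e. the number of roots of $p$ in $\Delta$ counted with multiplicity. For a positive integer $q$ let $\omega=e^{2\pi \mathbf{i}/q}$ (where $\mathbf{i}=\sqrt{-1}$) and $$s_0^*=\frac{r}{q}\sum_{g=0}^{q-1}\omega^{g}\,\frac{p'(c+r\omega^g)}{p(c+r\omega^g)}.$$ Then: (i) for every positive integer $q$, $\displaystyle |s_0^*-s_0|\le \frac{d\,\theta^{q}}{1-\theta^{q}}$; (ii) for every real $e>0$, if $q=\left\lceil \log_{\theta}\!\left(\frac{e}{d+e}\right)\right\rceil$, then $|s_0^*-s_0|\le e$.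
   Context: $D(c,r)=\{z\in\mathbb{C} : |z-c|\le r\}$; for $\delta>0$, $\delta D(c,r)=D(c,\delta r)$. A disc $\Delta$ has isolation ratio $\rho$ for $p$ if $\rho>1$ and the set of roots of $p$ in $\frac{1}{\rho}\Delta$ equals the set of roots of $p$ in $\rho\Delta$. Here $e$ denotes an arbitrary positive real number (not Euler's constant) except in the expression $e^{2\pi\mathbf{i}/q}$, which is the usual complex exponential. *)

theory Defs
  imports "HOL-Analysis.Analysis" "HOL-Computational_Algebra.Polynomial"
begin

text \<open>
  The disc \<open>D(c, r)\<close> is \<^term>\<open>cball c r\<close>. Discs are passed as centre and radius, so that
  scaling a disc by \<open>\<delta>\<close> is \<^term>\<open>cball c (\<delta> * r)\<close>.
\<close>

definition roots_in :: "complex poly \<Rightarrow> complex set \<Rightarrow> complex set" where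
  "roots_in p S = {z \<in> S. poly p z = 0}"

definition isolation_ratio :: "complex poly \<Rightarrow> complex \<Rightarrow> real \<Rightarrow> real \<Rightarrow> bool" where
  "isolation_ratio p c r \<rho> \<longleftrightarrow>
     \<rho> > 1 \<and> roots_in p (cball c ((1 / \<rho>) * r)) = roots_in p (cball c (\<rho> * r))"

text \<open>
  The \<open>h\<close>-th power sum of the roots in \<open>S\<close>, with multiplicity. For \<open>h = 0\<close> it is the number of
  these roots, because \<open>0 ^ 0 = 1\<close>. The zero polynomial is not meant to occur as \<open>p\<close>.
\<close>

definition root_power_sum :: "nat \<Rightarrow> complex poly \<Rightarrow> complex set \<Rightarrow> complex" where
  "root_power_sum h p S = (\<Sum>z\<in>roots_in p S. of_nat (order z p) * z ^ h)"

definition unity_root :: "nat \<Rightarrow> complex" where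
  "unity_root q = exp (2 * complex_of_real pi * \<i> / of_nat q)"

definition s0_approx :: "complex poly \<Rightarrow> complex \<Rightarrow> real \<Rightarrow> nat \<Rightarrow> complex" where
  "s0_approx p c r q =
     of_real r / of_nat q *
       (\<Sum>g<q. unity_root q ^ g *
          (poly (pderiv p) (c + of_real r * unity_root q ^ g) /
           poly p (c + of_real r * unity_root q ^ g)))"

end

theory Submission
  imports Defs "HOL-Computational_Algebra.Fundamental_Theorem_Algebra"
begin

text \<open>
  The logarithmic derivative of \<open>p\<close> is the sum of \<open>1 / (x - z)\<close> over the roots \<open>z\<close>, with
  multiplicity, so the discretised contour integral is a sum of contributions of the single roots.
  With \<open>u = (z - c) / r\<close>, averaging \<open>\<omega>^g / (\<omega>^g - u)\<close> over the \<open>q\<close>-th roots of unity gives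
  exactly \<open>1 / (1 - u^q)\<close>. This differs by at most \<open>\<theta>^q / (1 - \<theta>^q)\<close> from \<open>1\<close> if
  \<open>\<bar>u\<bar> \<le> \<theta>\<close> and from \<open>0\<close> if \<open>\<bar>u\<bar> > 1 / \<theta>\<close>, and the isolation ratio excludes all other roots.
\<close>

section \<open>Power sums over the \<open>q\<close>-th roots of unity\<close>

lemma unity_root_power: "q > 0 \<Longrightarrow> unity_root q ^ q = 1"
  by (simp add: unity_root_def flip: exp_of_nat_mult)

lemma unity_root_power_eq_1_iff: "q > 0 \<Longrightarrow> unity_root q ^ k = 1 \<longleftrightarrow> q dvd k"
  using complex_root_unity_eq_1[of q k]
  by (simp add: unity_root_def mult_ac flip: exp_of_nat_mult)

lemma norm_unity_root [simp]: "norm (unity_root q) = 1"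
  by (simp add: unity_root_def)

lemma unity_root_nonzero [simp]: "unity_root q \<noteq> 0"
  by (simp add: unity_root_def)

text \<open>The common ratio is a \<open>q\<close>-th root of unity, and \<open>0 < k < q\<close>
  keeps it different from 1, so the closed form of the geometric sum has numerator 0.\<close>

lemma sum_unity_root_powers:
  assumes "0 < k" "k < q"
  shows "(\<Sum>g<q. (unity_root q ^ k) ^ g) = 0"
proof -
  have "unity_root q ^ k \<noteq> 1"
    using assms unity_root_power_eq_1_iff[of q k] by (auto dest: dvd_imp_le)
  moreover have "(unity_root q ^ k) ^ q = 1"
    using assms unity_root_power[of q] by (metis gr_implies_not0 mult.commute not_gr_zero power_mult power_one)
  ultimately show ?thesis
    by (simp add: geometric_sum)
qed

text \<open>Each summand is a finite geometric sum of length \<open>q\<close> in \<open>u\<close>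
  divided by a root of unity. Summing over all roots of unity cancels every power of
  \<open>u\<close> except the zeroth.\<close>

lemma sum_unity_root_kernel:
  assumes q: "q > 0" and u: "u ^ q \<noteq> 1"
  shows "(\<Sum>g<q. unity_root q ^ g / (unity_root q ^ g - u)) = of_nat q / (1 - u ^ q)"
proof -
  let ?w = "unity_root q"
  have "?w ^ g / (?w ^ g - u) = (\<Sum>k<q. u ^ k * inverse ((?w ^ k) ^ g)) / (1 - u ^ q)" for g
  proof -
    \<comment> \<open>Dividing by a \<open>q\<close>-th root of unity leaves the \<open>q\<close>-th
      power unchanged, so the denominator \<open>1 - v ^ q\<close> is the same for every
      \<open>g\<close>, and \<open>u ^ q \<noteq> 1\<close> excludes \<open>v = 1\<close>.\<close>
    define v where "v = u / ?w ^ g"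
    have "(?w ^ g) ^ q = 1"
      by (metis mult.commute power_mult power_one q unity_root_power)
    then have vq: "v ^ q = u ^ q"
      by (simp add: v_def power_divide)
    then have v1: "v \<noteq> 1"
      using u by auto
    have "?w ^ g / (?w ^ g - u) = 1 / (1 - v)"
      using v1 by (simp add: v_def field_simps)
    also have "\<dots> = (\<Sum>k<q. v ^ k) / (1 - u ^ q)"
      using v1 u one_diff_power_eq[of v q] by (simp add: vq field_simps)
    also have "(\<Sum>k<q. v ^ k) = (\<Sum>k<q. u ^ k * inverse ((?w ^ k) ^ g))"
      by (simp add: v_def power_divide field_simps flip: power_mult)
    finally show ?thesis .
  qed
  then have "(\<Sum>g<q. ?w ^ g / (?w ^ g - u))
      = (\<Sum>g<q. \<Sum>k<q. u ^ k * inverse ((?w ^ k) ^ g)) / (1 - u ^ q)"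
    by (simp add: sum_divide_distrib)
  also have "(\<Sum>g<q. \<Sum>k<q. u ^ k * inverse ((?w ^ k) ^ g))
      = (\<Sum>k<q. u ^ k * cnj (\<Sum>g<q. (?w ^ k) ^ g))"
  proof -
    \<comment> \<open>On the unit circle inversion is conjugation, which turns the sum of negative
      powers into the conjugate of a sum already evaluated.\<close>
    have "inverse ((?w ^ k) ^ g) = cnj ((?w ^ k) ^ g)" for k g
      by (rule inverse_unique, subst complex_norm_square[symmetric]) (simp add: norm_power)
    then show ?thesis
      by (subst sum.swap) (simp add: sum_distrib_left)
  qed
  also have "\<dots> = (\<Sum>k<q. if k = 0 then of_nat q else 0)"
    by (intro sum.cong) (auto simp: sum_unity_root_powers simp flip: cnj_sum)
  also have "\<dots> = of_nat q"
    using q by simp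
  finally show ?thesis .
qed

section \<open>Logarithmic derivatives and partial fractions\<close>

lemma logderiv_mult:
  fixes p q :: "'a::field poly"
  assumes "poly p x \<noteq> 0" "poly q x \<noteq> 0"
  shows "poly (pderiv (p * q)) x / poly (p * q) x
    = poly (pderiv p) x / poly p x + poly (pderiv q) x / poly q x"
  using assms by (simp add: pderiv_mult field_simps)

lemma logderiv_linear_power:
  fixes x z :: "'a::field"
  assumes "x \<noteq> z"
  shows "poly (pderiv ([:-z, 1:] ^ n)) x / poly ([:-z, 1:] ^ n) x = of_nat n / (x - z)"
proof (induction n)
  case (Suc n)
  show ?case
    using assms Suc logderiv_mult[of "[:-z, 1:]" x "[:-z, 1:] ^ n"]
    by (simp add: pderiv_pCons add_divide_distrib)
qed simp

lemma logderiv_prod_linear_power: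
  fixes x :: "'a::field"
  assumes "finite A" "x \<notin> A"
  shows "poly (pderiv (\<Prod>z\<in>A. [:-z, 1:] ^ n z)) x / poly (\<Prod>z\<in>A. [:-z, 1:] ^ n z) x
    = (\<Sum>z\<in>A. of_nat (n z) / (x - z))"
  using assms
proof (induction A rule: finite_induct)
  case (insert a A)
  have "poly (\<Prod>z\<in>A. [:-z, 1:] ^ n z) x \<noteq> 0" "poly ([:-a, 1:] ^ n a) x \<noteq> 0"
    using insert by (auto simp: poly_prod)
  from logderiv_mult[OF this(2,1)] show ?case
    using insert logderiv_linear_power[of x a "n a"] by simp
qed simp

lemma logderiv_complex_poly:
  fixes p :: "complex poly"
  assumes "poly p x \<noteq> 0"
  shows "poly (pderiv p) x / poly p x = (\<Sum>z | poly p z = 0. of_nat (order z p) / (x - z))"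
proof -
  define P where "P = (\<Prod>z | poly p z = 0. [:-z, 1:] ^ order z p)"
  have p0: "p \<noteq> 0"
    using assms by auto
  have p: "p = smult (lead_coeff p) P"
    using complex_poly_decompose[of p] by (simp add: P_def)
  \<comment> \<open>The nonzero leading coefficient cancels from the quotient.\<close>
  have "poly (pderiv p) x / poly p x = poly (pderiv P) x / poly P x"
    by (subst (1 2) p) (use p0 in \<open>simp add: pderiv_smult\<close>)
  also have "\<dots> = (\<Sum>z | poly p z = 0. of_nat (order z p) / (x - z))"
    unfolding P_def using p0 assms by (intro logderiv_prod_linear_power) (auto simp: poly_roots_finite)
  finally show ?thesis .
qed

lemma sum_order_eq_degree:
  fixes p :: "complex poly"
  assumes "p \<noteq> 0"
  shows "(\<Sum>z | poly p z = 0. order z p) = degree p"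
  using assms size_proots_complex[of p] by (simp add: size_multiset_overloaded_eq)

text \<open>Since no root lies on the circle, the sample points avoid the poles and each
  \<open>((z - c) / of_real r) ^ q\<close> differs from 1. After exchanging the two sums, the kernel
  identity applies to each root separately.\<close>

lemma s0_approx_eq_sum_roots:
  fixes p :: "complex poly"
  assumes r: "r > 0" and q: "q > 0"
    and circle: "\<And>z. poly p z = 0 \<Longrightarrow> norm (z - c) \<noteq> r"
  shows "s0_approx p c r q
    = (\<Sum>z | poly p z = 0. of_nat (order z p) / (1 - ((z - c) / of_real r) ^ q))"
proof -
  let ?w = "unity_root q" and ?x = "\<lambda>g. c + of_real r * unity_root q ^ g"
  let ?u = "\<lambda>z. (z - c) / of_real r"
  have px: "poly p (?x g) \<noteq> 0" for g
    using circle[of "?x g"] r by (auto simp: norm_mult norm_power)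
  have u1: "?u z ^ q \<noteq> 1" if "poly p z = 0" for z
  proof
    assume "?u z ^ q = 1"
    then have "norm (?u z) ^ q = 1"
      by (metis norm_one norm_power)
    then have "norm (?u z) = 1"
      using power_eq_1_iff[of "norm (?u z)" q] q by auto
    then show False
      using circle[OF that] r by (simp add: norm_divide)
  qed
  \<comment> \<open>The prefactor \<open>r\<close> is absorbed by rescaling the circle to the unit
    circle.\<close>
  have ratio: "of_real r * (?w ^ g * (m / (?x g - z))) = m * (?w ^ g / (?w ^ g - ?u z))" for m z g
  proof -
    have "?x g - z = of_real r * (?w ^ g - ?u z)"
      using r by (simp add: field_simps)
    then show ?thesis
      using r by simp
  qed
  have "s0_approx p c r q = (\<Sum>g<q. \<Sum>z | poly p z = 0.
      of_real r * (?w ^ g * (of_nat (order z p) / (?x g - z)))) / of_nat q"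
    by (simp add: s0_approx_def logderiv_complex_poly px sum_distrib_left sum_divide_distrib mult_ac)
  also have "\<dots> = (\<Sum>z | poly p z = 0. of_nat (order z p) *
      (\<Sum>g<q. ?w ^ g / (?w ^ g - ?u z))) / of_nat q"
    unfolding ratio by (subst sum.swap) (simp add: sum_distrib_left)
  also have "\<dots> = (\<Sum>z | poly p z = 0. of_nat (order z p) * (of_nat q / (1 - ?u z ^ q))) / of_nat q"
    using q u1 by (simp add: sum_unity_root_kernel)
  also have "\<dots> = (\<Sum>z | poly p z = 0. of_nat (order z p) / (1 - ?u z ^ q))"
    using q by (simp add: sum_divide_distrib)
  finally show ?thesis .
qed

section \<open>Error contributed by a single root\<close>

lemma kernel_error_inside:
  fixes u :: "'a::real_normed_field"
  assumes "q > 0" "\<theta> < 1" "norm u \<le> \<theta>"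
  shows "norm (1 / (1 - u ^ q) - 1) \<le> \<theta> ^ q / (1 - \<theta> ^ q)"
proof -
  have \<theta>0: "0 \<le> \<theta>"
    using assms norm_ge_zero order_trans by blast
  have \<theta>q: "\<theta> ^ q < 1"
    using assms \<theta>0 by (simp add: power_less_one_iff)
  have uq: "norm (u ^ q) \<le> \<theta> ^ q"
    using assms by (simp add: norm_power power_mono)
  have *: "1 - \<theta> ^ q \<le> norm (1 - u ^ q)"
    using norm_triangle_ineq2[of 1 "u ^ q"] uq by simp
  then have "1 - u ^ q \<noteq> 0"
    using \<theta>q by auto
  then have "1 / (1 - u ^ q) - 1 = u ^ q / (1 - u ^ q)"
    using diff_divide_distrib[of 1 "1 - u ^ q" "1 - u ^ q"] by simp
  then show ?thesis
    using frac_le[of "\<theta> ^ q" "norm (u ^ q)" "1 - \<theta> ^ q" "norm (1 - u ^ q)"] * uq \<theta>q \<theta>0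
    by (simp add: norm_divide)
qed

lemma kernel_error_outside:
  fixes u :: "'a::real_normed_field"
  assumes "q > 0" "0 < \<theta>" "\<theta> < 1" "1 / \<theta> \<le> norm u"
  shows "norm (1 / (1 - u ^ q)) \<le> \<theta> ^ q / (1 - \<theta> ^ q)"
proof -
  have \<theta>q: "\<theta> ^ q < 1" "0 < \<theta> ^ q"
    using assms by (simp_all add: power_less_one_iff)
  have "1 / \<theta> ^ q \<le> norm (u ^ q)"
    using assms power_mono[of "1 / \<theta>" "norm u" q] by (simp add: norm_power power_divide)
  \<comment> \<open>Here \<open>u ^ q\<close> dominates 1, so the reverse triangle inequality is
    used with the roles opposite to the inside case.\<close>
  then have "1 / \<theta> ^ q - 1 \<le> norm (1 - u ^ q)"
    using norm_triangle_ineq2[of "u ^ q" 1] by (simp add: norm_minus_commute)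
  then have "1 / norm (1 - u ^ q) \<le> 1 / (1 / \<theta> ^ q - 1)"
    using \<theta>q by (intro divide_left_mono mult_pos_pos) (auto intro: less_le_trans[rotated])
  also have "\<dots> = \<theta> ^ q / (1 - \<theta> ^ q)"
    using \<theta>q assms(2) by (simp add: field_simps)
  finally show ?thesis
    by (simp add: norm_divide)
qed

lemma s0_approx_error:
  fixes p :: "complex poly"
  assumes p0: "p \<noteq> 0" and r: "r > 0" and iso: "isolation_ratio p c r \<rho>"
    and \<theta>: "\<theta> = 1 / \<rho>" and q: "q > 0"
  shows "norm (s0_approx p c r q - root_power_sum 0 p (cball c r))
    \<le> real (degree p) * \<theta> ^ q / (1 - \<theta> ^ q)"
proof -
  let ?u = "\<lambda>z. (z - c) / of_real r"
  let ?i = "\<lambda>z. if norm (z - c) \<le> r then 1 else 0 :: complex"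
  let ?B = "\<theta> ^ q / (1 - \<theta> ^ q)"
  have \<rho>: "\<rho> > 1"
    using iso by (simp add: isolation_ratio_def)
  then have \<theta>1: "0 < \<theta>" "\<theta> < 1"
    using \<theta> by simp_all
  \<comment> \<open>A root in the larger disc already lies in the smaller one, so the annulus
    between them contains no roots.\<close>
  have dich: "norm (z - c) \<le> \<theta> * r \<or> \<rho> * r < norm (z - c)" if "poly p z = 0" for z
  proof (rule disjCI)
    assume "\<not> \<rho> * r < norm (z - c)"
    then have "z \<in> roots_in p (cball c (\<rho> * r))"
      using that by (simp add: roots_in_def dist_norm norm_minus_commute)
    then have "z \<in> roots_in p (cball c (\<theta> * r))"
      using iso \<theta> by (simp add: isolation_ratio_def)
    then show "norm (z - c) \<le> \<theta> * r"
      by (simp add: roots_in_def dist_norm norm_minus_commute)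
  qed
  have \<theta>r: "\<theta> * r < r" and \<rho>r: "r < \<rho> * r"
    using \<theta>1 \<rho> r by simp_all
  have circle: "norm (z - c) \<noteq> r" if "poly p z = 0" for z
    using dich[OF that] \<theta>r \<rho>r by linarith
  have term_le: "norm (1 / (1 - ?u z ^ q) - ?i z) \<le> ?B" if "poly p z = 0" for z
    using dich[OF that]
  proof
    assume z: "norm (z - c) \<le> \<theta> * r"
    then have "norm (?u z) \<le> \<theta>"
      using r by (simp add: norm_divide field_simps)
    from kernel_error_inside[OF q \<theta>1(2) this] show ?thesis
      using z \<theta>r by simp
  next
    assume z: "\<rho> * r < norm (z - c)"
    then have "1 / \<theta> \<le> norm (?u z)"
      using r \<theta> by (simp add: norm_divide field_simps)
    from kernel_error_outside[OF q \<theta>1 this] show ?thesis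
      using z \<rho>r by simp
  qed
  have fin: "finite {z. poly p z = 0}"
    using p0 by (rule poly_roots_finite)
  \<comment> \<open>The indicator \<open>?i\<close> extends the count to all roots, so that it can
    be subtracted term by term.\<close>
  have "root_power_sum 0 p (cball c r) = (\<Sum>z | poly p z = 0. of_nat (order z p) * ?i z)"
    unfolding root_power_sum_def roots_in_def
    by (rule sum.mono_neutral_cong_left) (use fin in \<open>auto simp: dist_norm norm_minus_commute\<close>)
  then have "s0_approx p c r q - root_power_sum 0 p (cball c r)
      = (\<Sum>z | poly p z = 0. of_nat (order z p) * (1 / (1 - ?u z ^ q) - ?i z))"
    using s0_approx_eq_sum_roots[OF r q circle]
    by (simp add: right_diff_distrib sum_subtractf)
  also have "norm \<dots> \<le> (\<Sum>z | poly p z = 0. real (order z p) * ?B)"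
    by (rule sum_norm_le) (use term_le in \<open>simp add: norm_mult mult_left_mono del: times_divide_eq_right\<close>)
  also have "\<dots> = real (degree p) * \<theta> ^ q / (1 - \<theta> ^ q)"
    by (simp add: sum_order_eq_degree[OF p0, symmetric] sum_distrib_right sum_divide_distrib)
  finally show ?thesis .
qed

text \<open>With \<open>t = \<theta> ^ q < 1\<close>, the bound
  \<open>d * t / (1 - t) \<le> e\<close> rearranges to \<open>t \<le> e / (d + e)\<close>. The
  logarithm to a base below 1 is decreasing, so rounding up its value at \<open>e / (d + e)\<close>
  gives a sufficient exponent.\<close>

lemma error_bound_le_of_ceiling_log:
  fixes d e \<theta> :: real
  assumes \<theta>: "0 < \<theta>" "\<theta> < 1" and d: "d > 0" and e: "e > 0"
    and q: "int q = \<lceil>log \<theta> (e / (d + e))\<rceil>"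
  shows "q > 0" and "d * \<theta> ^ q / (1 - \<theta> ^ q) \<le> e"
proof -
  define y where "y = e / (d + e)"
  have y: "0 < y" "y < 1"
    using d e by (simp_all add: y_def)
  \<comment> \<open>Base and argument both lie in (0, 1), so both natural logarithms are negative.
    Hence the ceiling is at least 1, as part (i) requires.\<close>
  have "log \<theta> y > 0"
    using \<theta> y by (simp add: log_def divide_neg_neg)
  then show q0: "q > 0"
    using q by (simp add: y_def flip: of_nat_0_less_iff[where ?'a = int])
  have "log \<theta> y \<le> real q"
    using q by (simp add: y_def) linarith
  \<comment> \<open>Multiplying by the negative number \<open>ln \<theta>\<close> reverses the
    inequality.\<close>
  then have "ln y \<ge> real q * ln \<theta>"
    using \<theta> by (simp add: log_def neg_divide_le_eq)
  then have "\<theta> ^ q \<le> y"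
    using \<theta> y by (metis ln_le_cancel_iff ln_realpow zero_less_power)
  then have "\<theta> ^ q * (d + e) \<le> e"
    using d e by (simp add: y_def field_simps)
  moreover have "\<theta> ^ q < 1"
    using \<theta> q0 by (simp add: power_less_one_iff)
  ultimately show "d * \<theta> ^ q / (1 - \<theta> ^ q) \<le> e"
    by (simp add: field_simps)
qed

theorem theorem3:
  fixes p :: "complex poly" and c :: complex and r \<rho> \<theta> :: real and d :: nat and s0 :: complex
  assumes "degree p = d" and "d \<ge> 1"
    and "r > 0"
    and "isolation_ratio p c r \<rho>"
    and "\<theta> = 1 / \<rho>"
    and "s0 = root_power_sum 0 p (cball c r)"
  shows "(\<forall>q::nat. q > 0 \<longrightarrow>
            norm (s0_approx p c r q - s0) \<le> real d * \<theta> ^ q / (1 - \<theta> ^ q)) \<and>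
         (\<forall>(e::real) (q::nat). e > 0 \<longrightarrow> int q = \<lceil>log \<theta> (e / (real d + e))\<rceil> \<longrightarrow>
            norm (s0_approx p c r q - s0) \<le> e)"
proof -
  have "p \<noteq> 0"
    using assms by auto
  then have bound: "norm (s0_approx p c r q - s0) \<le> real d * \<theta> ^ q / (1 - \<theta> ^ q)" if "q > 0" for q
    using s0_approx_error[of p r c \<rho> \<theta> q] assms that by simp
  have "0 < \<theta>" "\<theta> < 1"
    using assms by (simp_all add: isolation_ratio_def)
  then have "norm (s0_approx p c r q - s0) \<le> e"
    if "e > 0" "int q = \<lceil>log \<theta> (e / (real d + e))\<rceil>" for e q
    using error_bound_le_of_ceiling_log[of \<theta> "real d" e q] bound[of q] that assms(2)
    by linarith
  with bound show ?thesis
    by blast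
qed

end
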